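(* Let $\tilde{\mathbb D}^*:=\varprojlim(E_n,p_{(n,m)})$. The maps $e_n:\mathbb H/n\mathbb Z\to\mathbb D^*$, $e_n(z)=\exp\left(2\pi i\frac zn\right)$, assemble into an isomorphism $\exp:\Gamma_{\mathbb Q,\mathrm{cl}}\to\tilde{\mathbb D}^*$.
   Context: $\mathbb D^*=\{q\in\mathbb C:0<|q|<1\}$ is the punctured open unit disk. The projective system is indexed by the positive integers ordered by divisibility: $E_n:=\mathbb D^*$ and, for $m=na$, $p_{(n,m)}:E_m\to E_n$, $p_{(n,m)}(z)=z^a$. $\Gamma_{\mathbb Q,\mathrm{cl}}$ (the classical orbit) is $G\times\mathbb R_+^*$, where $G=\mathbb A_{\mathbb Q}/(\mathbb Q,+)=\varprojlim(G_n,\gamma_{n,m})$, $G_n=\mathbb R/n\mathbb Z$, $\gamma_{n,m}(x+m\mathbb Z)=x+n\mathbb Z$ for $n\mid m$; thus $\Gamma_{\mathbb Q,\mathrm{cl}}=\varprojlim\mathbb H/n\mathbb Z$, with $(x,y)\in G_n\times\mathbb R_+^*$ identified with $x+iy\in\mathbb H/n\mathbb Z$ and transition maps the canonical projections $\mathbb H/m\mathbb Z\to\mathbb H/n\mathbb Z$ for $n\mid m$. $\mathbb H$ is the open upper half-plane. *)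

theory Defs
  imports "HOL-Complex_Analysis.Complex_Analysis"
begin

text \<open>Quotients by \<open>n\<int>\<close>, used both for \<open>\<real>/n\<int>\<close> and for \<open>\<H>/n\<int>\<close>; points are cosets \<open>x + n\<int>\<close>.\<close>

definition zcoset :: "nat \<Rightarrow> 'a::ring_1 \<Rightarrow> 'a set" where
  "zcoset n x = {x + of_int k * of_nat n | k. True}"

definition quotient_mod :: "'a::{ring_1,topological_space} set \<Rightarrow> nat \<Rightarrow> 'a set topology" where
  "quotient_mod S n =
     topology (\<lambda>U. U \<subseteq> zcoset n ` S \<and> openin (top_of_set S) {x \<in> S. zcoset n x \<in> U})"

lemma openin_quotient_mod:
  "openin (quotient_mod S n) U \<longleftrightarrow>
     U \<subseteq> zcoset n ` S \<and> openin (top_of_set S) {x \<in> S. zcoset n x \<in> U}"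
proof -
  let ?P = "\<lambda>U. U \<subseteq> zcoset n ` S \<and> openin (top_of_set S) {x \<in> S. zcoset n x \<in> U}"
  have "istopology ?P"
    unfolding istopology_def
  proof (intro conjI allI impI)
    fix A B assume "?P A" "?P B"
    moreover have "{x \<in> S. zcoset n x \<in> A \<inter> B} =
        {x \<in> S. zcoset n x \<in> A} \<inter> {x \<in> S. zcoset n x \<in> B}" by auto
    ultimately show "A \<inter> B \<subseteq> zcoset n ` S"
      and "openin (top_of_set S) {x \<in> S. zcoset n x \<in> A \<inter> B}" by (auto intro: openin_Int)
  next
    fix K assume K: "\<forall>A\<in>K. ?P A"
    have "{x \<in> S. zcoset n x \<in> \<Union>K} = \<Union>((\<lambda>A. {x \<in> S. zcoset n x \<in> A}) ` K)" by auto
    moreover have "openin (top_of_set S) (\<Union>((\<lambda>A. {x \<in> S. zcoset n x \<in> A}) ` K))"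
      using K by (intro openin_Union) auto
    ultimately show "openin (top_of_set S) {x \<in> S. zcoset n x \<in> \<Union>K}" by simp
    show "\<Union>K \<subseteq> zcoset n ` S" using K by blast
  qed
  then show ?thesis
    by (simp add: quotient_mod_def)
qed

lemma topspace_quotient_mod: "topspace (quotient_mod S n) = zcoset n ` S"
proof
  have "{x \<in> S. zcoset n x \<in> zcoset n ` S} = S" by auto
  then have "openin (quotient_mod S n) (zcoset n ` S)" 
    by (simp add: openin_quotient_mod)
  then show "zcoset n ` S \<subseteq> topspace (quotient_mod S n)" by (rule openin_subset)
  show "topspace (quotient_mod S n) \<subseteq> zcoset n ` S"
    using openin_quotient_mod[of S n] openin_topspace by blast
qed

text \<open>The canonical projection from cosets of \<open>m\<int>\<close> to cosets of \<open>n\<int>\<close> for \<open>n dvd m\<close>,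
  \<open>x + m\<int> \<mapsto> x + n\<int>\<close>, written without choosing a representative.\<close>

definition zproj :: "nat \<Rightarrow> nat \<Rightarrow> 'a::ring_1 set \<Rightarrow> 'a set" where
  "zproj n m c = (\<Union>x\<in>c. zcoset n x)"

lemma zproj_zcoset:
  assumes "n dvd m"
  shows "zproj n m (zcoset m x) = zcoset n x"
proof
  obtain a where m: "m = n * a" using assms by blast
  show "zproj n m (zcoset m x) \<subseteq> zcoset n x"
  proof
    fix y assume "y \<in> zproj n m (zcoset m x)"
    then obtain k j :: int where y: "y = x + of_int k * of_nat m + of_int j * of_nat n"
      unfolding zproj_def zcoset_def by blast
    have "of_nat m = (of_nat a * of_nat n :: 'a)"
      unfolding m by (metis mult.commute of_nat_mult)
    with y have "y = x + of_int (k * int a + j) * of_nat n"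
      by (simp add: distrib_right mult.assoc add.assoc)
    then show "y \<in> zcoset n x" unfolding zcoset_def by blast
  qed
  have "x = x + of_int 0 * of_nat m" by simp
  then have "x \<in> zcoset m x"
    unfolding zcoset_def by blast
  then show "zcoset n x \<subseteq> zproj n m (zcoset m x)"
    unfolding zproj_def by blast
qed

text \<open>Projective limits over the positive integers ordered by divisibility;
  \<open>p n m\<close> is the transition map from level \<open>m\<close> to level \<open>n\<close>. Points are families
  indexed by \<open>{0<..}\<close>, which are \<open>undefined\<close> at index 0.\<close>

definition proj_lim :: "(nat \<Rightarrow> 'a topology) \<Rightarrow> (nat \<Rightarrow> nat \<Rightarrow> 'a \<Rightarrow> 'a) \<Rightarrow> (nat \<Rightarrow> 'a) topology" where
  "proj_lim X p = subtopology (product_topology X {0<..})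
     {x. \<forall>n m. 0 < n \<and> 0 < m \<and> n dvd m \<longrightarrow> p n m (x m) = x n}"

definition lim_map :: "(nat \<Rightarrow> 'a \<Rightarrow> 'b) \<Rightarrow> (nat \<Rightarrow> 'a) \<Rightarrow> nat \<Rightarrow> 'b" where
  "lim_map f x = (\<lambda>n\<in>{0<..}. f n (x n))"

definition punctured_disk :: "complex set" where
  "punctured_disk = {q. 0 < cmod q \<and> cmod q < 1}"

definition upper_half :: "complex set" where
  "upper_half = {z. 0 < Im z}"

definition p_disk :: "nat \<Rightarrow> nat \<Rightarrow> complex \<Rightarrow> complex" where
  "p_disk n m z = z ^ (m div n)"

definition disk_lim :: "(nat \<Rightarrow> complex) topology" where
  "disk_lim = proj_lim (\<lambda>n. top_of_set punctured_disk) p_disk"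

abbreviation HmodZ :: "nat \<Rightarrow> complex set topology" where
  "HmodZ \<equiv> quotient_mod upper_half"

definition solenoid :: "(nat \<Rightarrow> real set) topology" where
  "solenoid = proj_lim (quotient_mod UNIV) zproj"

definition Gamma_cl :: "((nat \<Rightarrow> real set) \<times> real) topology" where
  "Gamma_cl = prod_topology solenoid (top_of_set {0<..})"

text \<open>The identification of \<open>G \<times> \<real>\<^sub>+\<^sup>*\<close> with the limit of the \<open>\<H>/n\<int>\<close>: at level \<open>n\<close>,
  the pair \<open>(x + n\<int>, y)\<close> goes to the coset \<open>(x + \<i>y) + n\<int>\<close>.\<close>

definition Gamma_to_HmodZ_lim :: "(nat \<Rightarrow> real set) \<times> real \<Rightarrow> nat \<Rightarrow> complex set" where
  "Gamma_to_HmodZ_lim = (\<lambda>(\<xi>, y). \<lambda>n\<in>{0<..}. (\<lambda>x. Complex x y) ` \<xi> n)"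

text \<open>The value on a coset is the common value of \<open>exp (2\<pi>\<i>z/n)\<close> at its elements.\<close>

definition e_map :: "nat \<Rightarrow> complex set \<Rightarrow> complex" where
  "e_map n c = the_elem ((\<lambda>z. exp (2 * of_real pi * \<i> * z / of_nat n)) ` c)"

definition exp_Gamma :: "(nat \<Rightarrow> real set) \<times> real \<Rightarrow> nat \<Rightarrow> complex" where
  "exp_Gamma \<gamma> = lim_map e_map (Gamma_to_HmodZ_lim \<gamma>)"

text \<open>\<open>\<H>/n\<int>\<close> carries the quotient complex structure: a function on an open subset is
  holomorphic iff its pullback to \<open>\<H>\<close> is. An isomorphism of Riemann surfaces is a
  homeomorphism that identifies the sheaves of holomorphic functions.\<close>

definition holomorphic_HmodZ :: "nat \<Rightarrow> complex set set \<Rightarrow> (complex set \<Rightarrow> complex) \<Rightarrow> bool" where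
  "holomorphic_HmodZ n U f \<longleftrightarrow>
     (\<lambda>z. f (zcoset n z)) holomorphic_on {z \<in> upper_half. zcoset n z \<in> U}"

definition biholomorphic_to_disk :: "nat \<Rightarrow> (complex set \<Rightarrow> complex) \<Rightarrow> bool" where
  "biholomorphic_to_disk n e \<longleftrightarrow>
     homeomorphic_map (HmodZ n) (top_of_set punctured_disk) e \<and>
     (\<forall>V f. open V \<and> V \<subseteq> punctured_disk \<longrightarrow>
        (f holomorphic_on V \<longleftrightarrow>
         holomorphic_HmodZ n {c \<in> topspace (HmodZ n). e c \<in> V} (f \<circ> e)))"

end

theory Submission
  imports Defs
begin

text \<open>
  Everything rests on one function on the complex plane, \<open>z \<mapsto> exp (2\<pi>\<i>z/n)\<close>. Its fibres are
  exactly the cosets of \<open>n\<int>\<close>, so it induces an injection on cosets, and near every nonzero value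
  it has a holomorphic section, a rescaled logarithm (\<open>cover_exp_local_section\<close>).

  At a finite level the local sections do all the work. They show that the map from the upper
  half-plane to the punctured disk is a topological quotient map; the half-plane modulo \<open>n\<int>\<close> is
  the quotient by the same equivalence relation, so the induced bijection is a homeomorphism.
  They also show that a function \<open>f\<close> is holomorphic as soon as its pullback is, because locally
  \<open>f\<close> is the pullback composed with a section.

  The limit is treated in polar coordinates. Since \<open>exp (2\<pi>\<i>(x + \<i>y)/n)\<close> is
  \<open>exp (2\<pi>\<i>x/n) \<cdot> exp (-2\<pi>y/n)\<close>, its direction depends only on \<open>x + n\<int>\<close> and its modulus only
  on \<open>y\<close>. The first factor identifies \<open>\<real>/n\<int>\<close> with the unit circle, by compactness of \<open>[0,n]\<close>.
  Hence a point \<open>q\<close> of the limit of disks gives back the coset at level \<open>n\<close> from the direction of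
  \<open>q\<^sub>n\<close>, and the height \<open>y\<close> from \<open>\<bar>q\<^sub>1\<bar>\<close> alone: the relation \<open>q\<^sub>1 = q\<^sub>n^n\<close> determines all the other
  moduli. Both this inverse and the map itself are continuous coordinate by coordinate, which is
  all that the topology of a projective limit asks for.
\<close>

section \<open>The exponential on cosets\<close>

definition cover_exp :: "nat \<Rightarrow> complex \<Rightarrow> complex" where
  "cover_exp n z = exp (2 * of_real pi * \<i> * z / of_nat n)"

lemma mem_zcoset_self: "x \<in> zcoset n x"
  unfolding zcoset_def by (auto intro: exI[of _ 0])

lemma zcoset_eq_range: "zcoset n x = range (\<lambda>k. x + of_int k * of_nat n)"
  unfolding zcoset_def by auto

lemma mem_zcoset_iff: "y \<in> zcoset n x \<longleftrightarrow> (\<exists>k. y = x + of_int k * of_nat n)"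
  unfolding zcoset_def by auto

lemma zcoset_eq_iff: "zcoset n x = zcoset n y \<longleftrightarrow> x \<in> zcoset n y"
proof
  assume "x \<in> zcoset n y"
  then obtain k where x: "x = y + of_int k * of_nat n" by (auto simp: mem_zcoset_iff)
  have "y + of_int k * of_nat n + of_int j * of_nat n = y + of_int (k + j) * of_nat n"
    and "y + of_int j * of_nat n
           = y + of_int k * of_nat n + of_int (j - k) * of_nat n" for j
    by (simp_all add: algebra_simps)
  then show "zcoset n x = zcoset n y"
    unfolding set_eq_iff mem_zcoset_iff x by metis
qed (metis mem_zcoset_self)

lemma cover_exp_eq_iff:
  assumes "0 < n"
  shows "cover_exp n z = cover_exp n w \<longleftrightarrow> zcoset n z = zcoset n w"
proof -
  have "2 * of_real pi * \<i> * z / of_nat n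
          = 2 * of_real pi * \<i> * w / of_nat n + (of_int (2 * k) * of_real pi) * \<i>
        \<longleftrightarrow> z = w + of_int k * of_nat n" (is "?L \<longleftrightarrow> ?R") for k
  proof -
    have "?L \<longleftrightarrow> (2 * of_real pi * \<i>) * z = (2 * of_real pi * \<i>) * (w + of_int k * of_nat n)"
      using assms by (simp add: field_simps)
    then show ?thesis by (simp only: mult_cancel_left) simp
  qed
  then show ?thesis
    unfolding cover_exp_def exp_eq zcoset_eq_iff mem_zcoset_iff by simp
qed

lemma e_map_zcoset:
  assumes "0 < n"
  shows "e_map n (zcoset n z) = cover_exp n z"
proof -
  have "cover_exp n ` zcoset n z = {cover_exp n z}"
    using cover_exp_eq_iff[OF assms] zcoset_eq_iff mem_zcoset_self by blast
  then show ?thesis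
    unfolding e_map_def cover_exp_def[abs_def] by simp
qed

lemma cover_exp_power:
  assumes "0 < n" "0 < m" "n dvd m"
  shows "cover_exp n z = cover_exp m z ^ (m div n)"
proof -
  have "of_nat (m div n) * (2 * of_real pi * \<i> * z / of_nat m) = 2 * of_real pi * \<i> * z / of_nat n"
    using assms by (auto elim!: dvdE simp: field_simps)
  then show ?thesis
    unfolding cover_exp_def by (metis exp_of_nat_mult)
qed

lemma norm_cover_exp: "cmod (cover_exp n z) = exp (- 2 * pi * Im z / real n)"
  by (simp add: cover_exp_def Re_divide_of_nat)

lemma cover_exp_in_punctured_disk_iff:
  assumes "0 < n"
  shows "cover_exp n z \<in> punctured_disk \<longleftrightarrow> z \<in> upper_half"
  using assms pi_gt_zero
  by (auto simp: punctured_disk_def upper_half_def norm_cover_exp cover_exp_def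
      zero_less_mult_iff zero_less_divide_iff)

lemma holomorphic_cover_exp: "cover_exp n holomorphic_on S"
  unfolding cover_exp_def[abs_def] by (cases "n = 0") (auto intro!: holomorphic_intros)

lemma open_upper_half: "open upper_half"
  unfolding upper_half_def by (simp add: open_halfspace_Im_gt)

lemma cover_exp_surj:
  assumes "0 < n" "w \<noteq> 0"
  obtains z where "cover_exp n z = w"
  using that[of "of_nat n * Ln w / (2 * of_real pi * \<i>)"] assms
  by (simp add: cover_exp_def)

text \<open>The section is \<open>z\<^sub>0\<close> plus a multiple of \<open>Ln (w / w\<^sub>0)\<close>: dividing by the base value \<open>w\<^sub>0\<close>
  puts the argument of the logarithm near \<open>1\<close>, away from the branch cut, and makes the section
  pass through the prescribed preimage \<open>z\<^sub>0\<close>.\<close>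

lemma cover_exp_local_section:
  assumes "0 < n"
  obtains N s where "open N" "cover_exp n z0 \<in> N" "s holomorphic_on N"
    "s (cover_exp n z0) = z0" "\<And>w. w \<in> N \<Longrightarrow> cover_exp n (s w) = w"
proof
  define w0 where "w0 = cover_exp n z0"
  define N where "N = (\<lambda>w. w / w0) -` (- \<real>\<^sub>\<le>\<^sub>0)"
  define s where "s = (\<lambda>w. z0 + of_nat n * Ln (w / w0) / (2 * of_real pi * \<i>))"
  have w0: "w0 \<noteq> 0" by (simp add: w0_def cover_exp_def)
  show "open N" unfolding N_def
    using w0 by (intro open_vimage continuous_intros) (auto simp: open_Compl)
  show "cover_exp n z0 \<in> N" using w0 by (simp add: N_def flip: w0_def)
  show "s holomorphic_on N" unfolding s_def N_def
    using w0 by (intro holomorphic_intros) auto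
  show "s (cover_exp n z0) = z0" using w0 by (simp add: s_def flip: w0_def)
  show "cover_exp n (s w) = w" if "w \<in> N" for w
  proof -
    have w: "w / w0 \<noteq> 0" using that by (auto simp: N_def)
    have "2 * of_real pi * \<i> * s w / of_nat n
            = 2 * of_real pi * \<i> * z0 / of_nat n + Ln (w / w0)"
      using assms unfolding s_def by (simp add: field_simps)
    then have "cover_exp n (s w) = w0 * (w / w0)"
      using exp_Ln[OF w] by (simp only: cover_exp_def[of n "s w"] exp_add) (simp add: w0_def cover_exp_def)
    then show ?thesis using w0 by simp
  qed
qed

section \<open>The isomorphism at a finite level\<close>

lemma continuous_map_zcoset: "continuous_map (top_of_set S) (quotient_mod S n) (zcoset n)"
  by (auto simp: continuous_map_def topspace_quotient_mod openin_quotient_mod)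

lemma continuous_map_from_quotient_mod:
  assumes "continuous_map (top_of_set S) Y (g \<circ> zcoset n)"
  shows "continuous_map (quotient_mod S n) Y g"
  unfolding continuous_map_def
proof (intro conjI allI impI)
  show "g \<in> topspace (quotient_mod S n) \<rightarrow> topspace Y"
    using assms by (auto simp: continuous_map_def topspace_quotient_mod)
  fix U assume "openin Y U"
  then have "openin (top_of_set S) {x \<in> S. (g \<circ> zcoset n) x \<in> U}"
    using assms by (auto simp: continuous_map_def)
  moreover have "{x \<in> S. zcoset n x \<in> {c \<in> zcoset n ` S. g c \<in> U}}
                   = {x \<in> S. (g \<circ> zcoset n) x \<in> U}" by auto
  ultimately show "openin (quotient_mod S n) {c \<in> topspace (quotient_mod S n). g c \<in> U}"
    unfolding topspace_quotient_mod openin_quotient_mod by auto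
qed

text \<open>Two quotient maps with the same fibres have homeomorphic targets. The map \<open>j\<close> into \<open>S\<close>
  allows \<open>g \<circ> zcoset n\<close> to be tested on a convenient part of \<open>S\<close> only, such as a compact
  fundamental domain.\<close>

lemma homeomorphic_map_from_quotient_mod:
  assumes g: "continuous_map (top_of_set S) Y (g \<circ> zcoset n)"
    and j: "continuous_map X (top_of_set S) j"
    and q: "quotient_map X Y (g \<circ> zcoset n \<circ> j)"
    and inj: "inj_on g (zcoset n ` S)"
  shows "homeomorphic_map (quotient_mod S n) Y g"
proof -
  have "continuous_map X (quotient_mod S n) (zcoset n \<circ> j)"
    using j continuous_map_zcoset by (rule continuous_map_compose)
  moreover have "quotient_map X Y (g \<circ> (zcoset n \<circ> j))" using q by (simp only: comp_assoc)
  ultimately have "quotient_map (quotient_mod S n) Y g"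
    by (rule quotient_map_from_composition[OF _ continuous_map_from_quotient_mod[OF g]])
  then show ?thesis
    using inj by (simp add: homeomorphic_map_def topspace_quotient_mod)
qed

lemma inj_on_e_map:
  assumes "0 < n"
  shows "inj_on (e_map n) (zcoset n ` S)"
  using cover_exp_eq_iff[OF assms] by (auto simp: inj_on_def e_map_zcoset[OF assms])

text \<open>If the preimage of \<open>U\<close> is open, then near each of its points \<open>U\<close> contains the preimage of
  that open set under a continuous local section, so \<open>U\<close> is open.\<close>

lemma quotient_map_cover_exp:
  assumes n: "0 < n"
  shows "quotient_map (top_of_set upper_half) (top_of_set punctured_disk) (cover_exp n)"
  unfolding quotient_map_def
proof (intro conjI allI impI)
  show img: "cover_exp n ` topspace (top_of_set upper_half) = topspace (top_of_set punctured_disk)"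
  proof
    show "topspace (top_of_set punctured_disk) \<subseteq> cover_exp n ` topspace (top_of_set upper_half)"
    proof
      fix w assume "w \<in> topspace (top_of_set punctured_disk)"
      then have w: "w \<in> punctured_disk" by simp
      then have "w \<noteq> 0" by (auto simp: punctured_disk_def)
      then obtain z where "cover_exp n z = w" using cover_exp_surj n by blast
      then show "w \<in> cover_exp n ` topspace (top_of_set upper_half)"
        using w cover_exp_in_punctured_disk_iff[OF n, of z] by auto
    qed
  qed (use cover_exp_in_punctured_disk_iff[OF n] in auto)
  fix U assume "U \<subseteq> topspace (top_of_set punctured_disk)"
  then have U: "U \<subseteq> punctured_disk" by simp
  let ?P = "{z \<in> topspace (top_of_set upper_half). cover_exp n z \<in> U}"
  show "openin (top_of_set upper_half) ?P \<longleftrightarrow> openin (top_of_set punctured_disk) U"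
  proof
    assume "openin (top_of_set upper_half) ?P"
    then have P: "open ?P" using open_upper_half openin_open_eq by blast
    have "open U"
    proof (subst open_subopen, intro ballI)
      fix w assume w: "w \<in> U"
      then have "w \<in> cover_exp n ` upper_half" using U img by auto
      then obtain z0 where z0: "z0 \<in> upper_half" "cover_exp n z0 = w" by blast
      obtain N s where s: "open N" "w \<in> N" "s holomorphic_on N" "s w = z0"
          "\<And>v. v \<in> N \<Longrightarrow> cover_exp n (s v) = v"
        using cover_exp_local_section[OF n, of z0] z0(2) by metis
      have "open (N \<inter> s -` ?P)"
        using s(1,3) P by (intro continuous_open_preimage holomorphic_on_imp_continuous_on)
      moreover have "w \<in> N \<inter> s -` ?P" using s z0 w by auto
      moreover have "N \<inter> s -` ?P \<subseteq> U" using s(5) by auto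
      ultimately show "\<exists>T. open T \<and> w \<in> T \<and> T \<subseteq> U" by blast
    qed
    then show "openin (top_of_set punctured_disk) U"
      using U by (metis openin_open_Int inf.absorb2)
  next
    assume "openin (top_of_set punctured_disk) U"
    moreover have "continuous_map (top_of_set upper_half) (top_of_set punctured_disk) (cover_exp n)"
      using holomorphic_cover_exp[of n upper_half] img
      by (auto simp: continuous_map_in_subtopology intro: holomorphic_on_imp_continuous_on)
    ultimately show "openin (top_of_set upper_half) ?P"
      by (rule openin_continuous_map_preimage[rotated])
  qed
qed

lemma homeomorphic_map_e_map:
  assumes n: "0 < n"
  shows "homeomorphic_map (HmodZ n) (top_of_set punctured_disk) (e_map n)"
proof (rule homeomorphic_map_from_quotient_mod)
  have eq: "e_map n \<circ> zcoset n = cover_exp n" by (simp add: fun_eq_iff e_map_zcoset[OF n])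
  show "quotient_map (top_of_set upper_half) (top_of_set punctured_disk)
          (e_map n \<circ> zcoset n \<circ> id)"
    using quotient_map_cover_exp[OF n] by (simp add: eq)
  then show "continuous_map (top_of_set upper_half) (top_of_set punctured_disk)
               (e_map n \<circ> zcoset n)"
    unfolding comp_id by (rule quotient_imp_continuous_map)
qed (use inj_on_e_map[OF n] in \<open>auto simp: id_def\<close>)

text \<open>Holomorphy descends along \<open>cover_exp n\<close> because, near a given value, \<open>f\<close> is its own
  pullback composed with a holomorphic section.\<close>

lemma holomorphic_on_pullback_cover_exp_iff:
  assumes n: "0 < n" and V: "open V" "V \<subseteq> punctured_disk"
  shows "f holomorphic_on V
           \<longleftrightarrow> (\<lambda>z. f (cover_exp n z)) holomorphic_on {z \<in> upper_half. cover_exp n z \<in> V}"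
    (is "_ \<longleftrightarrow> ?g holomorphic_on ?P")
proof
  assume "f holomorphic_on V"
  then have "(f \<circ> cover_exp n) holomorphic_on ?P"
    by (rule holomorphic_on_compose_gen[OF holomorphic_cover_exp]) auto
  then show "?g holomorphic_on ?P" by (simp add: o_def)
next
  assume g: "?g holomorphic_on ?P"
  have "?P = upper_half \<inter> cover_exp n -` V" by auto
  then have P: "open ?P"
    using continuous_open_preimage[OF holomorphic_on_imp_continuous_on[OF holomorphic_cover_exp]
        open_upper_half V(1)] by simp
  have "f analytic_on V"
    unfolding analytic_on_holomorphic
  proof -
    have "\<exists>T. open T \<and> w \<in> T \<and> f holomorphic_on T" if w: "w \<in> V" for w
    proof -
      have "w \<in> cover_exp n ` upper_half"
        using quotient_imp_surjective_map[OF quotient_map_cover_exp[OF n]] w V(2) by auto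
      then obtain z0 where z0: "z0 \<in> upper_half" "cover_exp n z0 = w" by blast
      obtain N s where s: "open N" "w \<in> N" "s holomorphic_on N" "s w = z0"
          "\<And>v. v \<in> N \<Longrightarrow> cover_exp n (s v) = v"
        using cover_exp_local_section[OF n, of z0] z0(2) by metis
      let ?T = "N \<inter> s -` ?P"
      have "open ?T"
        using s(1,3) P by (intro continuous_open_preimage holomorphic_on_imp_continuous_on)
      moreover have "w \<in> ?T" using s z0 w by auto
      moreover have "(?g \<circ> s) holomorphic_on ?T"
        by (rule holomorphic_on_compose_gen[OF holomorphic_on_subset[OF s(3)] g]) auto
      then have "f holomorphic_on ?T"
        by (rule holomorphic_transform) (simp add: s(5))
      ultimately show ?thesis by blast
    qed
    then show "\<exists>T. open T \<and> V \<subseteq> T \<and> f holomorphic_on T"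
      by (metis analytic_on_analytic_at analytic_at analytic_on_holomorphic)
  qed
  then show "f holomorphic_on V" by (rule analytic_imp_holomorphic)
qed

lemma biholomorphic_to_disk_e_map:
  assumes n: "0 < n"
  shows "biholomorphic_to_disk n (e_map n)"
proof -
  have "{z \<in> upper_half. zcoset n z \<in> {c \<in> topspace (HmodZ n). e_map n c \<in> V}}
          = {z \<in> upper_half. cover_exp n z \<in> V}" for V
    by (auto simp: topspace_quotient_mod e_map_zcoset[OF n])
  then show ?thesis
    unfolding biholomorphic_to_disk_def holomorphic_HmodZ_def
    using homeomorphic_map_e_map[OF n] holomorphic_on_pullback_cover_exp_iff[OF n]
    by (simp add: e_map_zcoset[OF n])
qed

lemma e_map_zproj:
  assumes "0 < n" "0 < m" "n dvd m"
  shows "e_map n (zproj n m (zcoset m z)) = e_map m (zcoset m z) ^ (m div n)"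
  using assms by (simp add: zproj_zcoset e_map_zcoset flip: cover_exp_power)

section \<open>The circle coordinate\<close>

text \<open>A coset of \<open>n\<int>\<close> in \<open>\<real>\<close> is also one in \<open>\<complex>\<close>, so the coordinate identifying \<open>\<real>/n\<int>\<close> with the
  unit circle is the restriction of \<open>e_map n\<close> to the real axis.\<close>

definition circle_coord :: "nat \<Rightarrow> real set \<Rightarrow> complex" where
  "circle_coord n c = e_map n (complex_of_real ` c)"

lemma Complex_image_zcoset: "(\<lambda>x. Complex x y) ` zcoset n x = zcoset n (Complex x y)"
proof -
  have "Complex (x + of_int k * of_nat n) y = Complex x y + of_int k * of_nat n" for k
    by (simp add: complex_eq_iff)
  then show ?thesis by (simp add: zcoset_eq_range image_image)
qed

lemma circle_coord_zcoset:
  assumes "0 < n"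
  shows "circle_coord n (zcoset n x) = cover_exp n (of_real x)"
  using Complex_image_zcoset[of 0 n x] assms
  by (simp add: circle_coord_def e_map_zcoset complex_of_real_def)

text \<open>The polar decomposition of the exponential, which separates the two factors of
  \<open>G \<times> \<real>\<^sub>+\<^sup>*\<close>.\<close>

lemma e_map_Complex_zcoset:
  assumes "0 < n"
  shows "e_map n ((\<lambda>x. Complex x y) ` zcoset n x)
           = circle_coord n (zcoset n x) * of_real (exp (- 2 * pi * y / real n))"
proof -
  have "2 * of_real pi * \<i> * Complex x y / of_nat n
          = 2 * of_real pi * \<i> * of_real x / of_nat n + of_real (- 2 * pi * y / real n)"
    by (simp add: complex_eq_iff Re_divide_of_nat Im_divide_of_nat)
  then show ?thesis
    using assms
    by (simp only: Complex_image_zcoset e_map_zcoset circle_coord_zcoset cover_exp_def exp_add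
        exp_of_real)
qed

lemma circle_coord_zproj:
  assumes "0 < n" "0 < m" "n dvd m" "c \<in> range (zcoset m)"
  shows "circle_coord n (zproj n m c) = circle_coord m c ^ (m div n)"
  using assms by (auto simp: zproj_zcoset circle_coord_zcoset simp flip: cover_exp_power)

lemma inj_on_circle_coord:
  assumes n: "0 < n"
  shows "inj_on (circle_coord n) (range (zcoset n))"
proof (rule inj_onI, clarify)
  fix x y assume "circle_coord n (zcoset n x) = circle_coord n (zcoset n y)"
  then have "of_real x \<in> zcoset n (complex_of_real y)"
    using n by (simp add: circle_coord_zcoset cover_exp_eq_iff zcoset_eq_iff)
  then obtain k where "complex_of_real x = of_real (y + of_int k * of_nat n)"
    by (auto simp: mem_zcoset_iff)
  then have "x = y + of_int k * of_nat n" by (simp only: of_real_eq_iff)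
  then show "zcoset n x = zcoset n y" by (auto simp: zcoset_eq_iff mem_zcoset_iff)
qed

text \<open>The compact interval \<open>[0,n]\<close> already covers the circle, and a continuous surjection from a
  compact space onto a Hausdorff space is a quotient map.\<close>

lemma homeomorphic_map_circle_coord:
  assumes n: "0 < n"
  shows "homeomorphic_map (quotient_mod UNIV n) (top_of_set (sphere 0 1)) (circle_coord n)"
proof (rule homeomorphic_map_from_quotient_mod)
  let ?f = "\<lambda>x. cover_exp n (complex_of_real x)"
  let ?I = "{0..real n}"
  have eq: "circle_coord n \<circ> zcoset n = ?f" by (simp add: fun_eq_iff circle_coord_zcoset[OF n])
  have cont: "continuous_on S ?f" for S
    unfolding cover_exp_def using n by (intro continuous_intros) auto
  have sph: "?f x \<in> sphere 0 1" for x by (simp add: norm_cover_exp)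
  show "continuous_map (top_of_set UNIV) (top_of_set (sphere 0 1)) (circle_coord n \<circ> zcoset n)"
    unfolding eq using cont sph by (auto simp: continuous_map_in_subtopology)
  show "continuous_map (top_of_set ?I) (top_of_set UNIV) id" by simp
  have "sphere 0 1 \<subseteq> ?f ` ?I"
  proof
    fix w :: complex assume "w \<in> sphere 0 1"
    then have w: "exp (\<i> * of_real (Arg2pi w)) = w"
      by (simp flip: complex_norm_eq_1_exp)
    let ?x = "real n * (Arg2pi w / (2 * pi))"
    have "?f ?x = w" using n w by (simp add: cover_exp_def)
    moreover have "?x \<in> ?I"
      using Arg2pi_ge_0[of w] Arg2pi_lt_2pi[of w]
        mult_left_le[of "Arg2pi w / (2 * pi)" "real n"] by simp
    ultimately show "w \<in> ?f ` ?I" by (metis imageI)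
  qed
  then have "?f ` ?I = sphere 0 1" using sph by blast
  then show "quotient_map (top_of_set ?I) (top_of_set (sphere 0 1)) (circle_coord n \<circ> zcoset n \<circ> id)"
    unfolding eq using cont
    by (intro continuous_imp_quotient_map)
       (auto simp: continuous_map_in_subtopology compact_space_subtopology Hausdorff_space_subtopology)
qed (rule inj_on_circle_coord[OF n])

section \<open>Passage to the limit\<close>

lemma topspace_proj_lim:
  "topspace (proj_lim X p) = {x \<in> extensional {0<..}. (\<forall>n>0. x n \<in> topspace (X n)) \<and>
      (\<forall>n m. 0 < n \<and> 0 < m \<and> n dvd m \<longrightarrow> p n m (x m) = x n)}"
  by (simp add: proj_lim_def PiE_iff set_eq_iff Ball_def conj_ac)

lemma continuous_map_proj_lim_coord:
  assumes "0 < n"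
  shows "continuous_map (proj_lim X p) (X n) (\<lambda>x. x n)"
  unfolding proj_lim_def using assms
  by (intro continuous_map_from_subtopology continuous_map_product_projection) auto

lemma continuous_map_into_proj_lim:
  assumes "\<And>n. 0 < n \<Longrightarrow> continuous_map Y (X n) (\<lambda>y. f y n)"
    and "\<And>y. y \<in> topspace Y \<Longrightarrow> f y \<in> extensional {0<..}"
    and "\<And>y n m. y \<in> topspace Y \<Longrightarrow> 0 < n \<Longrightarrow> 0 < m \<Longrightarrow> n dvd m \<Longrightarrow> p n m (f y m) = f y n"
  shows "continuous_map Y (proj_lim X p) f"
  unfolding proj_lim_def continuous_map_in_subtopology continuous_map_componentwise
  using assms by auto

lemma exp_Gamma_apply:
  assumes "0 < n" "\<xi> n \<in> range (zcoset n)"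
  shows "exp_Gamma (\<xi>, y) n = circle_coord n (\<xi> n) * of_real (exp (- 2 * pi * y / real n))"
  using assms by (auto simp: exp_Gamma_def lim_map_def Gamma_to_HmodZ_lim_def e_map_Complex_zcoset)

lemma norm_circle_coord:
  assumes "0 < n" "c \<in> range (zcoset n)"
  shows "cmod (circle_coord n c) = 1"
  using assms by (auto simp: circle_coord_zcoset norm_cover_exp)

definition circle_coord_inv :: "nat \<Rightarrow> complex \<Rightarrow> real set" where
  "circle_coord_inv n = inv_into (range (zcoset n)) (circle_coord n)"

lemma
  assumes n: "0 < n"
  shows circle_coord_inv_in_range: "cmod w = 1 \<Longrightarrow> circle_coord_inv n w \<in> range (zcoset n)"
    and circle_coord_circle_coord_inv: "cmod w = 1 \<Longrightarrow> circle_coord n (circle_coord_inv n w) = w"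
    and circle_coord_inv_circle_coord:
      "c \<in> range (zcoset n) \<Longrightarrow> circle_coord_inv n (circle_coord n c) = c"
    and continuous_map_circle_coord_inv:
      "continuous_map (top_of_set (sphere 0 1)) (quotient_mod UNIV n) (circle_coord_inv n)"
proof -
  note h = homeomorphic_map_circle_coord[OF n]
  have surj: "circle_coord n ` range (zcoset n) = sphere 0 1"
    using homeomorphic_imp_surjective_map[OF h] by (simp add: topspace_quotient_mod)
  show "cmod w = 1 \<Longrightarrow> circle_coord_inv n w \<in> range (zcoset n)"
    unfolding circle_coord_inv_def by (rule inv_into_into) (simp add: surj)
  show fw: "cmod w = 1 \<Longrightarrow> circle_coord n (circle_coord_inv n w) = w" for w
    unfolding circle_coord_inv_def by (rule f_inv_into_f) (simp add: surj)
  show bw: "c \<in> range (zcoset n) \<Longrightarrow> circle_coord_inv n (circle_coord n c) = c" for c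
    unfolding circle_coord_inv_def by (rule inv_into_f_f[OF inj_on_circle_coord[OF n]])
  obtain g where g: "homeomorphic_maps (quotient_mod UNIV n) (top_of_set (sphere 0 1)) (circle_coord n) g"
    using h homeomorphic_map_maps by blast
  have "g w = circle_coord_inv n w" if "w \<in> sphere 0 1" for w
  proof -
    obtain c where "c \<in> range (zcoset n)" "w = circle_coord n c" using surj \<open>w \<in> sphere 0 1\<close> by blast
    then show ?thesis
      using g bw by (auto simp: homeomorphic_maps_def topspace_quotient_mod)
  qed
  then show "continuous_map (top_of_set (sphere 0 1)) (quotient_mod UNIV n) (circle_coord_inv n)"
    using g by (auto simp: homeomorphic_maps_def intro: continuous_map_eq)
qed

text \<open>The inverse of \<open>exp_Gamma\<close>: directions give the cosets, and \<open>\<bar>q\<^sub>1\<bar> = exp (-2\<pi>y)\<close> gives the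
  height.\<close>

definition log_Gamma :: "(nat \<Rightarrow> complex) \<Rightarrow> (nat \<Rightarrow> real set) \<times> real" where
  "log_Gamma q = (\<lambda>n\<in>{0<..}. circle_coord_inv n (sgn (q n)), - ln (cmod (q 1)) / (2 * pi))"

lemma topspace_disk_lim:
  "q \<in> topspace disk_lim \<longleftrightarrow> q \<in> extensional {0<..} \<and> (\<forall>n>0. q n \<in> punctured_disk) \<and>
     (\<forall>n m. 0 < n \<and> 0 < m \<and> n dvd m \<longrightarrow> q m ^ (m div n) = q n)"
  by (auto simp: disk_lim_def topspace_proj_lim p_disk_def)

lemma topspace_Gamma_cl:
  "(\<xi>, y) \<in> topspace Gamma_cl \<longleftrightarrow> \<xi> \<in> extensional {0<..} \<and> (\<forall>n>0. \<xi> n \<in> range (zcoset n)) \<and>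
     (\<forall>n m. 0 < n \<and> 0 < m \<and> n dvd m \<longrightarrow> zproj n m (\<xi> m) = \<xi> n) \<and> 0 < y"
  by (auto simp: Gamma_cl_def solenoid_def topspace_proj_lim topspace_quotient_mod)

lemma continuous_map_mult_euclidean:
  fixes f g :: "'a \<Rightarrow> 'b::real_normed_algebra"
  assumes "continuous_map X euclidean f" "continuous_map X euclidean g"
  shows "continuous_map X euclidean (\<lambda>x. f x * g x)"
  using assms by (simp add: continuous_map_atin tendsto_mult)

lemma continuous_map_exp_Gamma: "continuous_map Gamma_cl disk_lim exp_Gamma"
  unfolding disk_lim_def
proof (rule continuous_map_into_proj_lim)
  fix n :: nat assume n: "0 < n"
  let ?h = "\<lambda>\<gamma>. circle_coord n (fst \<gamma> n) * of_real (exp (- 2 * pi * snd \<gamma> / real n))"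
  have eq: "exp_Gamma \<gamma> n = ?h \<gamma>" if "\<gamma> \<in> topspace Gamma_cl" for \<gamma>
    using that n by (cases \<gamma>) (simp add: topspace_Gamma_cl exp_Gamma_apply)
  have \<xi>: "continuous_map Gamma_cl (quotient_mod UNIV n) (\<lambda>\<gamma>. fst \<gamma> n)"
    unfolding Gamma_cl_def solenoid_def
    using continuous_map_compose[OF continuous_map_fst continuous_map_proj_lim_coord[OF n]]
    by (simp add: o_def)
  have "continuous_map (quotient_mod UNIV n) euclidean (circle_coord n)"
    using homeomorphic_imp_continuous_map[OF homeomorphic_map_circle_coord[OF n]]
    by (simp add: continuous_map_in_subtopology)
  from continuous_map_compose[OF \<xi> this]
  have c: "continuous_map Gamma_cl euclidean (\<lambda>\<gamma>. circle_coord n (fst \<gamma> n))"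
    by (simp add: o_def)
  have y: "continuous_map Gamma_cl (top_of_set {0<..}) snd"
    unfolding Gamma_cl_def by (rule continuous_map_snd)
  have "continuous_map (top_of_set {0<..}) euclidean
                   (\<lambda>y. complex_of_real (exp (- 2 * pi * y / real n)))"
    using n by (simp, intro continuous_intros) auto
  from continuous_map_compose[OF y this]
  have "continuous_map Gamma_cl euclidean
      (\<lambda>\<gamma>. complex_of_real (exp (- 2 * pi * snd \<gamma> / real n)))"
    by (simp add: o_def)
  with c have "continuous_map Gamma_cl euclidean ?h" by (rule continuous_map_mult_euclidean)
  moreover have "?h \<gamma> \<in> punctured_disk" if "\<gamma> \<in> topspace Gamma_cl" for \<gamma>
    using that n norm_circle_coord[OF n, of "fst \<gamma> n"]
    by (cases \<gamma>) (auto simp: topspace_Gamma_cl punctured_disk_def norm_mult)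
  ultimately have "continuous_map Gamma_cl (top_of_set punctured_disk) ?h"
    by (auto simp: continuous_map_in_subtopology)
  then show "continuous_map Gamma_cl (top_of_set punctured_disk) (\<lambda>\<gamma>. exp_Gamma \<gamma> n)"
    by (rule continuous_map_eq) (simp add: eq)
next
  fix \<gamma> show "exp_Gamma \<gamma> \<in> extensional {0<..}" by (simp add: exp_Gamma_def lim_map_def)
next
  fix \<gamma> and n m :: nat
  assume \<gamma>: "\<gamma> \<in> topspace Gamma_cl" and nm: "0 < n" "0 < m" "n dvd m"
  obtain \<xi> y where [simp]: "\<gamma> = (\<xi>, y)" by force
  have \<xi>: "\<xi> m \<in> range (zcoset m)" "\<xi> n \<in> range (zcoset n)" "zproj n m (\<xi> m) = \<xi> n"
    using \<gamma> nm by (auto simp: topspace_Gamma_cl)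
  have "real (m div n) * (- 2 * pi * y / real m) = - 2 * pi * y / real n"
    using nm by (auto elim!: dvdE simp: field_simps)
  then have "exp (- 2 * pi * y / real m) ^ (m div n) = exp (- 2 * pi * y / real n)"
    by (metis exp_of_nat_mult)
  then show "p_disk n m (exp_Gamma \<gamma> m) = exp_Gamma \<gamma> n"
    using nm \<xi> circle_coord_zproj[OF nm \<xi>(1)]
    by (simp add: p_disk_def exp_Gamma_apply power_mult_distrib flip: of_real_power)
qed

lemma continuous_map_log_Gamma: "continuous_map disk_lim Gamma_cl log_Gamma"
proof -
  have q: "continuous_map disk_lim (top_of_set punctured_disk) (\<lambda>q. q n)" if "0 < n" for n
    unfolding disk_lim_def using continuous_map_proj_lim_coord[OF that] by auto
  have "continuous_map disk_lim solenoid (\<lambda>q. \<lambda>n\<in>{0<..}. circle_coord_inv n (sgn (q n)))"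
    unfolding solenoid_def
  proof (rule continuous_map_into_proj_lim)
    fix n :: nat assume n: "0 < n"
    have "continuous_map (top_of_set punctured_disk) (top_of_set (sphere 0 1)) sgn"
      by (auto simp: continuous_map_in_subtopology punctured_disk_def norm_sgn
          intro!: continuous_intros)
    then have "continuous_map disk_lim (quotient_mod UNIV n) (circle_coord_inv n \<circ> (sgn \<circ> (\<lambda>q. q n)))"
      by (intro continuous_map_compose[OF _ continuous_map_circle_coord_inv[OF n]]
          continuous_map_compose[OF q[OF n]])
    then show "continuous_map disk_lim (quotient_mod UNIV n)
                 (\<lambda>q. (\<lambda>n\<in>{0<..}. circle_coord_inv n (sgn (q n))) n)"
      using n by (simp add: o_def)
  next
    fix q and n m :: nat
    assume q: "q \<in> topspace disk_lim" and nm: "0 < n" "0 < m" "n dvd m"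
    have norm: "cmod (sgn (q k)) = 1" if "0 < k" for k
      using q that by (auto simp: topspace_disk_lim norm_sgn punctured_disk_def)
    let ?c = "\<lambda>k. circle_coord_inv k (sgn (q k))"
    have c: "?c m \<in> range (zcoset m)" "?c n \<in> range (zcoset n)"
      using nm norm circle_coord_inv_in_range by blast+
    \<comment> \<open>Compatibility is checked in the circle coordinate, where it is \<open>sgn (q\<^sub>m^a) = (sgn q\<^sub>m)^a\<close>.\<close>
    have "circle_coord n (zproj n m (?c m)) = sgn (q m) ^ (m div n)"
      using nm norm c by (simp add: circle_coord_zproj circle_coord_circle_coord_inv)
    also have "\<dots> = sgn (q m ^ (m div n))" 
      by (simp add: sgn_div_norm norm_power scaleR_conv_of_real power_mult_distrib power_inverse)
    also have "\<dots> = sgn (q n)" using q nm by (simp add: topspace_disk_lim)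
    also have "\<dots> = circle_coord n (?c n)"
      using nm norm by (simp add: circle_coord_circle_coord_inv)
    finally have "zproj n m (?c m) = ?c n"
      using inj_on_circle_coord[OF nm(1)] c nm
      by (auto simp: zproj_zcoset dest!: inj_onD)
    then show "zproj n m ((\<lambda>n\<in>{0<..}. ?c n) m) = (\<lambda>n\<in>{0<..}. ?c n) n"
      using nm by simp
  qed auto
  moreover have "continuous_map disk_lim (top_of_set {0<..})
                   ((\<lambda>w. - ln (cmod w) / (2 * pi)) \<circ> (\<lambda>q. q 1))"
  proof (rule continuous_map_compose[OF q])
    show "continuous_map (top_of_set punctured_disk) (top_of_set {0<..})
            (\<lambda>w. - ln (cmod w) / (2 * pi))"
      by (auto simp: continuous_map_in_subtopology punctured_disk_def divide_neg_pos
          intro!: continuous_intros)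
  qed simp
  ultimately show ?thesis
    unfolding Gamma_cl_def log_Gamma_def[abs_def] by (simp add: continuous_map_pairedI o_def)
qed

lemma log_Gamma_exp_Gamma:
  assumes "\<gamma> \<in> topspace Gamma_cl"
  shows "log_Gamma (exp_Gamma \<gamma>) = \<gamma>"
proof -
  obtain \<xi> y where [simp]: "\<gamma> = (\<xi>, y)" by force
  have \<xi>: "\<xi> \<in> extensional {0<..}" and r: "\<xi> n \<in> range (zcoset n)" if "0 < n" for n
    using assms that by (auto simp: topspace_Gamma_cl)
  have "circle_coord_inv n (sgn (exp_Gamma \<gamma> n)) = \<xi> n" if n: "0 < n" for n
  proof -
    have "sgn (exp_Gamma \<gamma> n) = sgn (circle_coord n (\<xi> n))"
      using r n by (simp add: exp_Gamma_apply sgn_mult sgn_of_real)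
    also have "\<dots> = circle_coord n (\<xi> n)"
      using norm_circle_coord[OF n r[OF n]] by (simp add: sgn_div_norm)
    finally show ?thesis using r n by (simp add: circle_coord_inv_circle_coord)
  qed
  then have "(\<lambda>n\<in>{0<..}. circle_coord_inv n (sgn (exp_Gamma \<gamma> n))) = \<xi>"
    using \<xi>[of 1] by (auto simp: fun_eq_iff extensional_def)
  moreover have "cmod (exp_Gamma \<gamma> 1) = exp (- 2 * pi * y)"
    using r[of 1] by (simp add: exp_Gamma_apply norm_mult norm_circle_coord)
  ultimately show ?thesis
    by (simp add: log_Gamma_def)
qed

lemma exp_Gamma_log_Gamma:
  assumes q: "q \<in> topspace disk_lim"
  shows "exp_Gamma (log_Gamma q) = q"
proof
  fix n
  show "exp_Gamma (log_Gamma q) n = q n"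
  proof (cases "0 < n")
    case False
    then show ?thesis
      using q by (simp add: topspace_disk_lim extensional_def exp_Gamma_def lim_map_def)
  next
    case n: True
    then have qn: "q n \<noteq> 0" using q by (auto simp: topspace_disk_lim punctured_disk_def)
    have "q n ^ (n div 1) = q 1"
      using q n unfolding topspace_disk_lim by (metis one_dvd zero_less_one)
    then have q1: "cmod (q 1) = cmod (q n) ^ n" by (metis div_by_1 norm_power)
    have s: "cmod (sgn (q n)) = 1" using qn by (simp add: norm_sgn)
    \<comment> \<open>The height was read off at level 1; \<open>q\<^sub>1 = q\<^sub>n^n\<close> makes it correct at level \<open>n\<close>.\<close>
    have "ln (cmod (q 1)) = real n * ln (cmod (q n))"
      unfolding q1 using qn by (simp add: ln_realpow)
    then have "exp (ln (cmod (q 1)) / real n) = cmod (q n)"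
      using n qn by simp
    then have "exp_Gamma (log_Gamma q) n = sgn (q n) * of_real (cmod (q n))"
      using n s
      by (simp add: log_Gamma_def exp_Gamma_apply circle_coord_inv_in_range
          circle_coord_circle_coord_inv)
    then show ?thesis using qn by (simp add: sgn_div_norm scaleR_conv_of_real)
  qed
qed

theorem proposition5p4:
  shows "(\<forall>n>0. \<forall>z\<in>upper_half.
            e_map n (zcoset n z) = exp (2 * of_real pi * \<i> * z / of_nat n))
       \<and> (\<forall>n>0. biholomorphic_to_disk n (e_map n))
       \<and> (\<forall>n m. 0 < n \<and> 0 < m \<and> n dvd m \<longrightarrow>
            (\<forall>c\<in>topspace (HmodZ m). e_map n (zproj n m c) = p_disk n m (e_map m c)))
       \<and> homeomorphic_map Gamma_cl disk_lim exp_Gamma"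
proof (intro conjI)
  show "\<forall>n>0. \<forall>z\<in>upper_half. e_map n (zcoset n z) = exp (2 * of_real pi * \<i> * z / of_nat n)"
    by (simp add: e_map_zcoset cover_exp_def)
  show "\<forall>n>0. biholomorphic_to_disk n (e_map n)"
    by (simp add: biholomorphic_to_disk_e_map)
  show "\<forall>n m. 0 < n \<and> 0 < m \<and> n dvd m \<longrightarrow>
          (\<forall>c\<in>topspace (HmodZ m). e_map n (zproj n m c) = p_disk n m (e_map m c))"
    by (auto simp: topspace_quotient_mod p_disk_def e_map_zproj)
  have "homeomorphic_maps Gamma_cl disk_lim exp_Gamma log_Gamma"
    by (simp add: homeomorphic_maps_def continuous_map_exp_Gamma continuous_map_log_Gamma
        log_Gamma_exp_Gamma exp_Gamma_log_Gamma)
  then show "homeomorphic_map Gamma_cl disk_lim exp_Gamma"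
    by (rule homeomorphic_maps_imp_map)
qed

end
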